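(* Let $\mathcal A$ be an almost disjoint family of infinite subsets of $\omega$. Then the Banach space $C(K_{\mathcal A})$ is not Grothendieck, and, if the ideal $\mathcal I(\mathcal A)$ is proper (i.e. $\omega\notin\mathcal I(\mathcal A)$), the Banach space $c_{0,\mathcal I(\mathcal A)}$ is not Grothendieck.
   Context: A family $\mathcal A$ of infinite subsets of $\omega$ is almost disjoint (AD) if $A\cap B$ is finite for any distinct $A,B\in\mathcal A$. $\mathcal I(\mathcal A)$ is the ideal of all $B\subseteq\omega$ for which there is a finite $\mathcal A_0\subseteq\mathcal A$ with $B\setminus\bigcup\mathcal A_0$ finite. $K_{\mathcal A}$ (the Franklin compactum) is the Stone space of the Boolean subalgebra $\mathbb B(\mathcal A)$ of $\mathcal P(\omega)$ generated by $\mathcal A\cup[\omega]^{<\omega}$, and $C(K)$ is the Banach space of real continuous functions on $K$ with the supremum norm. For an ideal $\mathcal I$ on $\omega$, $c_{0,\mathcal I}=\{(x_n)\in\ell_\infty:\ \forall\epsilon>0\ \{n:|x_n|\ge\epsilon\}\in\mathcal I\}$ with the supremum norm. A Banach space $X$ is Grothendieck if every weak$^*$ null sequence in $X^*$ is weakly null. *)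

theory Defs
  imports "HOL-Analysis.Analysis"
begin

section \<open>Real Banach spaces with explicit carriers\<close>

text \<open>
  The Stone space of a Boolean algebra, and hence the space of continuous functions on it, depends
  on a term and so cannot be a type. Banach spaces are therefore carriers with operations rather
  than instances of the class \<^class>\<open>banach\<close>.
\<close>

record 'a nvs =
  vcarrier :: "'a set"
  vzero :: 'a
  vadd :: "'a \<Rightarrow> 'a \<Rightarrow> 'a"
  vscale :: "real \<Rightarrow> 'a \<Rightarrow> 'a"
  vnorm :: "'a \<Rightarrow> real"

locale banach_space =
  fixes X :: "('a, 'm) nvs_scheme"
  assumes zero_closed: "vzero X \<in> vcarrier X"
    and add_closed: "\<lbrakk>x \<in> vcarrier X; y \<in> vcarrier X\<rbrakk> \<Longrightarrow> vadd X x y \<in> vcarrier X"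
    and scale_closed: "x \<in> vcarrier X \<Longrightarrow> vscale X c x \<in> vcarrier X"
    and add_assoc: "\<lbrakk>x \<in> vcarrier X; y \<in> vcarrier X; z \<in> vcarrier X\<rbrakk>
          \<Longrightarrow> vadd X (vadd X x y) z = vadd X x (vadd X y z)"
    and add_commute: "\<lbrakk>x \<in> vcarrier X; y \<in> vcarrier X\<rbrakk> \<Longrightarrow> vadd X x y = vadd X y x"
    and add_zero: "x \<in> vcarrier X \<Longrightarrow> vadd X x (vzero X) = x"
    and add_inverse: "x \<in> vcarrier X \<Longrightarrow> vadd X x (vscale X (- 1) x) = vzero X"
    and scale_add_right: "\<lbrakk>x \<in> vcarrier X; y \<in> vcarrier X\<rbrakk>
          \<Longrightarrow> vscale X c (vadd X x y) = vadd X (vscale X c x) (vscale X c y)"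
    and scale_add_left: "x \<in> vcarrier X
          \<Longrightarrow> vscale X (c + d) x = vadd X (vscale X c x) (vscale X d x)"
    and scale_scale: "x \<in> vcarrier X \<Longrightarrow> vscale X c (vscale X d x) = vscale X (c * d) x"
    and scale_one: "x \<in> vcarrier X \<Longrightarrow> vscale X 1 x = x"
    and norm_eq_zero: "x \<in> vcarrier X \<Longrightarrow> vnorm X x = 0 \<longleftrightarrow> x = vzero X"
    and norm_triangle: "\<lbrakk>x \<in> vcarrier X; y \<in> vcarrier X\<rbrakk>
          \<Longrightarrow> vnorm X (vadd X x y) \<le> vnorm X x + vnorm X y"
    and norm_scale: "x \<in> vcarrier X \<Longrightarrow> vnorm X (vscale X c x) = \<bar>c\<bar> * vnorm X x"
    and complete: "\<lbrakk>\<And>n::nat. s n \<in> vcarrier X;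
          \<And>e. e > 0 \<Longrightarrow> \<exists>N. \<forall>m\<ge>N. \<forall>n\<ge>N. vnorm X (vadd X (s m) (vscale X (- 1) (s n))) < e\<rbrakk>
          \<Longrightarrow> \<exists>x\<in>vcarrier X. (\<lambda>n. vnorm X (vadd X (s n) (vscale X (- 1) x))) \<longlonglongrightarrow> 0"

definition bounded_functionals :: "('a, 'm) nvs_scheme \<Rightarrow> ('a \<Rightarrow> real) set" where
  "bounded_functionals X = {f \<in> extensional (vcarrier X).
     (\<forall>x\<in>vcarrier X. \<forall>y\<in>vcarrier X. f (vadd X x y) = f x + f y) \<and>
     (\<forall>c. \<forall>x\<in>vcarrier X. f (vscale X c x) = c * f x) \<and>
     (\<exists>C. \<forall>x\<in>vcarrier X. \<bar>f x\<bar> \<le> C * vnorm X x)}"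

definition dual_space :: "('a, 'm) nvs_scheme \<Rightarrow> ('a \<Rightarrow> real) nvs" where
  "dual_space X =
     \<lparr>vcarrier = bounded_functionals X,
      vzero = (\<lambda>x\<in>vcarrier X. 0),
      vadd = (\<lambda>f g. \<lambda>x\<in>vcarrier X. f x + g x),
      vscale = (\<lambda>c f. \<lambda>x\<in>vcarrier X. c * f x),
      vnorm = (\<lambda>f. SUP x\<in>{x \<in> vcarrier X. vnorm X x \<le> 1}. \<bar>f x\<bar>)\<rparr>"

definition weakly_null :: "('a, 'm) nvs_scheme \<Rightarrow> (nat \<Rightarrow> 'a) \<Rightarrow> bool" where
  "weakly_null X s \<longleftrightarrow> (\<forall>n. s n \<in> vcarrier X) \<and>
     (\<forall>f\<in>vcarrier (dual_space X). (\<lambda>n. f (s n)) \<longlonglongrightarrow> 0)"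

definition weak_star_null :: "('a, 'm) nvs_scheme \<Rightarrow> (nat \<Rightarrow> 'a \<Rightarrow> real) \<Rightarrow> bool" where
  "weak_star_null X f \<longleftrightarrow> (\<forall>n. f n \<in> vcarrier (dual_space X)) \<and>
     (\<forall>x\<in>vcarrier X. (\<lambda>n. f n x) \<longlonglongrightarrow> 0)"

text \<open>Meant for \<^term>\<open>X\<close> satisfying \<^locale>\<open>banach_space\<close>.\<close>

definition grothendieck_space :: "('a, 'm) nvs_scheme \<Rightarrow> bool" where
  "grothendieck_space X \<longleftrightarrow> (\<forall>f. weak_star_null X f \<longrightarrow> weakly_null (dual_space X) f)"


section \<open>Function spaces with the supremum norm\<close>

text \<open>
  The members of \<^term>\<open>V\<close> should be bounded on \<^term>\<open>S\<close> and extensional, with \<^term>\<open>S\<close> nonempty: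
  the supremum of an empty or unbounded set of reals is unspecified.
\<close>

definition sup_norm_space :: "'i set \<Rightarrow> ('i \<Rightarrow> real) set \<Rightarrow> ('i \<Rightarrow> real) nvs" where
  "sup_norm_space S V =
     \<lparr>vcarrier = V,
      vzero = (\<lambda>i\<in>S. 0),
      vadd = (\<lambda>x y. \<lambda>i\<in>S. x i + y i),
      vscale = (\<lambda>c x. \<lambda>i\<in>S. c * x i),
      vnorm = (\<lambda>x. SUP i\<in>S. \<bar>x i\<bar>)\<rparr>"

definition continuous_function_space :: "'k topology \<Rightarrow> ('k \<Rightarrow> real) nvs" where
  "continuous_function_space K = sup_norm_space (topspace K)
     {f \<in> extensional (topspace K). continuous_map K euclideanreal f}"

definition c0_ideal :: "nat set set \<Rightarrow> (nat \<Rightarrow> real) nvs" where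
  "c0_ideal I = sup_norm_space UNIV
     {x. bounded (range x) \<and> (\<forall>e>0. {n. \<bar>x n\<bar> \<ge> e} \<in> I)}"


section \<open>Almost disjoint families\<close>

definition almost_disjoint_family :: "nat set set \<Rightarrow> bool" where
  "almost_disjoint_family \<A> \<longleftrightarrow>
     (\<forall>A\<in>\<A>. infinite A) \<and> (\<forall>A\<in>\<A>. \<forall>B\<in>\<A>. A \<noteq> B \<longrightarrow> finite (A \<inter> B))"

definition ad_ideal :: "nat set set \<Rightarrow> nat set set" where
  "ad_ideal \<A> = {B. \<exists>\<A>\<^sub>0. \<A>\<^sub>0 \<subseteq> \<A> \<and> finite \<A>\<^sub>0 \<and> finite (B - \<Union>\<A>\<^sub>0)}"

definition ad_algebra :: "nat set set \<Rightarrow> nat set set" where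
  "ad_algebra \<A> = algebra UNIV hull (\<A> \<union> {F. finite F})"

definition ultrafilters_of :: "'a set set \<Rightarrow> 'a set set set" where
  "ultrafilters_of \<B> = {U. U \<subseteq> \<B> \<and> UNIV \<in> U \<and> {} \<notin> U \<and>
     (\<forall>a\<in>U. \<forall>b\<in>U. a \<inter> b \<in> U) \<and>
     (\<forall>a\<in>U. \<forall>b\<in>\<B>. a \<subseteq> b \<longrightarrow> b \<in> U) \<and>
     (\<forall>b\<in>\<B>. b \<in> U \<or> - b \<in> U)}"

definition stone_space :: "'a set set \<Rightarrow> 'a set set topology" where
  "stone_space \<B> = topology_generated_by ((\<lambda>b. {U \<in> ultrafilters_of \<B>. b \<in> U}) ` \<B>)"

definition franklin_compactum :: "nat set set \<Rightarrow> nat set set topology" where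
  "franklin_compactum \<A> = stone_space (ad_algebra \<A>)"


section \<open>The two spaces are Banach spaces\<close>

lemma banach_space_sup_norm_space:
  assumes S: "S \<noteq> {}"
    and ext: "V \<subseteq> extensional S"
    and bdd: "\<And>x. x \<in> V \<Longrightarrow> bounded (x ` S)"
    and zero: "(\<lambda>i\<in>S. 0) \<in> V"
    and add: "\<And>x y. x \<in> V \<Longrightarrow> y \<in> V \<Longrightarrow> (\<lambda>i\<in>S. x i + y i) \<in> V"
    and scale: "\<And>c x. x \<in> V \<Longrightarrow> (\<lambda>i\<in>S. c * x i) \<in> V"
    and lim: "\<And>s x. (\<And>n::nat. s n \<in> V) \<Longrightarrow> x \<in> extensional S \<Longrightarrow>
                uniform_limit S s x sequentially \<Longrightarrow> x \<in> V"
  shows "banach_space (sup_norm_space S V)"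
proof -
  have bda: "bdd_above ((\<lambda>i. \<bar>x i\<bar>) ` S)" if x: "x \<in> V" for x
  proof -
    obtain B where "\<And>i. i \<in> S \<Longrightarrow> \<bar>x i\<bar> \<le> B"
      using bdd[OF x] unfolding bounded_iff by auto
    then show ?thesis by (auto intro!: bdd_aboveI2)
  qed
  have le: "\<bar>x i\<bar> \<le> (SUP i\<in>S. \<bar>x i\<bar>)" if "x \<in> V" "i \<in> S" for x i
    using cSUP_upper[OF that(2) bda[OF that(1)]] .
  have nonneg: "0 \<le> (SUP i\<in>S. \<bar>x i\<bar>)" if "x \<in> V" for x
    using le[OF that] S by (meson abs_ge_zero ex_in_conv order_trans)
  have ub: "(SUP i\<in>S. \<bar>x i\<bar>) \<le> B" if "\<And>i. i \<in> S \<Longrightarrow> \<bar>x i\<bar> \<le> B" for x :: "'a \<Rightarrow> real" and B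
    using S that by (rule cSUP_least)
  have eqI: "x = y" if "x \<in> extensional S" "y \<in> extensional S" "\<And>i. i \<in> S \<Longrightarrow> x i = y i"
    for x y :: "'a \<Rightarrow> real"
    using that by (rule extensionalityI)
  have diffV: "(\<lambda>i\<in>S. x i + (\<lambda>i\<in>S. - 1 * y i) i) \<in> V" if "x \<in> V" "y \<in> V" for x y
    using add[OF that(1) scale[OF that(2), of "-1"]] by simp
  show ?thesis
  proof (unfold_locales, goal_cases)
    case (10 x c d) 
    show ?case by (auto simp: sup_norm_space_def fun_eq_iff)
  next
    case (12 x)
    show ?case
    proof
      assume "vnorm (sup_norm_space S V) x = 0"
      then have "x i = 0" if "i \<in> S" for i
        using le[of x i] that 12 by (simp add: sup_norm_space_def)
      then show "x = vzero (sup_norm_space S V)"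
        using 12 ext by (auto simp: sup_norm_space_def intro!: eqI)
    next
      assume "x = vzero (sup_norm_space S V)"
      then have "(SUP i\<in>S. \<bar>x i\<bar>) = (SUP i\<in>S. 0)"
        by (intro SUP_cong) (auto simp: sup_norm_space_def)
      then show "vnorm (sup_norm_space S V) x = 0"
        using S by (simp add: sup_norm_space_def)
    qed
  next
    case (13 x y)
    then show ?case
      by (auto simp: sup_norm_space_def intro!: ub order_trans[OF abs_triangle_ineq] add_mono le)
  next
    case (14 x c)
    then have x: "x \<in> V" by (simp add: sup_norm_space_def)
    have "(SUP i\<in>S. \<bar>c * x i\<bar>) \<le> \<bar>c\<bar> * (SUP i\<in>S. \<bar>x i\<bar>)"
      by (rule ub) (simp add: abs_mult mult_left_mono le x)
    moreover have "\<bar>c\<bar> * (SUP i\<in>S. \<bar>x i\<bar>) \<le> (SUP i\<in>S. \<bar>c * x i\<bar>)"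
    proof (cases "c = 0")
      case True
      then show ?thesis using S by simp
    next
      case False
      have "(SUP i\<in>S. \<bar>x i\<bar>) \<le> (SUP i\<in>S. \<bar>c * x i\<bar>) / \<bar>c\<bar>"
      proof (rule ub)
        fix i assume i: "i \<in> S"
        have "\<bar>c * x i\<bar> \<le> (SUP i\<in>S. \<bar>c * x i\<bar>)"
          using le[OF scale[OF x, of c] i] i by (simp cong: SUP_cong)
        then show "\<bar>x i\<bar> \<le> (SUP i\<in>S. \<bar>c * x i\<bar>) / \<bar>c\<bar>"
          using False by (simp add: abs_mult pos_le_divide_eq mult.commute)
      qed
      then show ?thesis using False by (simp add: pos_le_divide_eq mult.commute)
    qed
    ultimately show ?case by (simp add: sup_norm_space_def cong: SUP_cong)
  next
    case (15 s)
    have s: "s n \<in> V" for n using 15(1) by (simp add: sup_norm_space_def)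
    have small: "\<exists>N. \<forall>m\<ge>N. \<forall>n\<ge>N. \<forall>i\<in>S. dist (s m i) (s n i) < e" if "e > 0" for e
    proof -
      obtain N where N: "\<And>m n. m \<ge> N \<Longrightarrow> n \<ge> N \<Longrightarrow>
          (SUP i\<in>S. \<bar>(\<lambda>i\<in>S. s m i + (\<lambda>i\<in>S. - 1 * s n i) i) i\<bar>) < e"
        using 15(2)[OF \<open>e > 0\<close>] by (auto simp: sup_norm_space_def)
      have "dist (s m i) (s n i) < e" if "m \<ge> N" "n \<ge> N" "i \<in> S" for m n i
        using le[OF diffV[OF s[of m] s[of n]] \<open>i \<in> S\<close>] N[OF that(1,2)] \<open>i \<in> S\<close>
        by (simp add: dist_real_def)
      then show ?thesis by blast
    qed
    have "uniformly_Cauchy_on S s"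
      unfolding uniformly_Cauchy_on_def using small by blast
    then obtain l where l: "uniform_limit S s l sequentially"
      using Cauchy_uniformly_convergent[of S s] by (auto simp: uniformly_convergent_on_def)
    define x where "x = restrict l S"
    have ux: "uniform_limit S s x sequentially"
      using l by (rule uniform_limit_cong'[THEN iffD1, rotated 2]) (auto simp: x_def)
    have x: "x \<in> V"
      using s ux by (intro lim[of s x]) (auto simp: x_def)
    have "(\<lambda>n. vnorm (sup_norm_space S V) (vadd (sup_norm_space S V) (s n) 
              (vscale (sup_norm_space S V) (- 1) x))) \<longlonglongrightarrow> 0"
    proof (rule tendstoI)
      fix e :: real assume e: "e > 0"
      have "\<forall>\<^sub>F n in sequentially. \<forall>i\<in>S. dist (s n i) (x i) < e / 2"
        using ux e unfolding uniform_limit_iff by (meson half_gt_zero)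
      then show "\<forall>\<^sub>F n in sequentially. dist (vnorm (sup_norm_space S V) (vadd (sup_norm_space S V) (s n) 
              (vscale (sup_norm_space S V) (- 1) x))) 0 < e"
      proof (eventually_elim)
        case (elim n)
        have "(SUP i\<in>S. \<bar>(\<lambda>i\<in>S. s n i + (\<lambda>i\<in>S. - 1 * x i) i) i\<bar>) \<le> e / 2"
          by (rule ub) (use elim in \<open>force simp: dist_real_def\<close>)
        then show ?case using nonneg[OF diffV[OF s[of n] x]] e
          by (simp add: sup_norm_space_def)
      qed
    qed
    then show ?case using x by (auto simp: sup_norm_space_def)
  qed (use zero add scale ext in \<open>auto simp: sup_norm_space_def fun_eq_iff algebra_simps extensional_def\<close>)
qed

lemma banach_space_continuous_function_space:
  assumes "compact_space K" "topspace K \<noteq> {}"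
  shows "banach_space (continuous_function_space K)"
  unfolding continuous_function_space_def
proof (rule banach_space_sup_norm_space)
  fix x assume "x \<in> {f \<in> extensional (topspace K). continuous_map K euclideanreal f}"
  then have "compactin euclideanreal (x ` topspace K)"
    using assms(1) image_compactin[of K "topspace K" euclideanreal x] by (auto simp: compact_space_def)
  then show "bounded (x ` topspace K)" by (simp add: compact_imp_bounded)
next
  fix s :: "nat \<Rightarrow> 'a \<Rightarrow> real" and x
  assume s: "\<And>n. s n \<in> {f \<in> extensional (topspace K). continuous_map K euclideanreal f}"
    and x: "x \<in> extensional (topspace K)" and u: "uniform_limit (topspace K) s x sequentially"
  have "continuous_map K euclideanreal x"
    using s u by (intro Met_TC.continuous_map_uniform_limit[where f = s and F = sequentially, simplified])
      (auto simp: uniform_limit_iff)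
  then show "x \<in> {f \<in> extensional (topspace K). continuous_map K euclideanreal f}"
    using x by simp
next
  fix x y assume "x \<in> {f \<in> extensional (topspace K). continuous_map K euclideanreal f}"
    "y \<in> {f \<in> extensional (topspace K). continuous_map K euclideanreal f}"
  then show "(\<lambda>i\<in>topspace K. x i + y i) \<in> {f \<in> extensional (topspace K). continuous_map K euclideanreal f}"
    using continuous_map_eq[where f = "\<lambda>i. x i + y i" and g = "\<lambda>i\<in>topspace K. x i + y i"]
    by (auto intro: continuous_map_add)
next
  fix x c assume "x \<in> {f \<in> extensional (topspace K). continuous_map K euclideanreal f}"
  then show "(\<lambda>i\<in>topspace K. c * x i) \<in> {f \<in> extensional (topspace K). continuous_map K euclideanreal f}"
    using continuous_map_eq[where f = "\<lambda>i. c * x i" and g = "\<lambda>i\<in>topspace K. c * x i"]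
    by (auto intro: continuous_map_real_mult_left)
next
  show "(\<lambda>i\<in>topspace K. 0) \<in> {f \<in> extensional (topspace K). continuous_map K euclideanreal f}"
    using continuous_map_eq[where f = "\<lambda>i. 0" and g = "\<lambda>i\<in>topspace K. 0" and X = K and X' = euclideanreal]
    by auto
qed (use assms in auto)

lemma banach_space_c0_ideal:
  assumes empty: "{} \<in> I" and un: "\<And>A B. A \<in> I \<Longrightarrow> B \<in> I \<Longrightarrow> A \<union> B \<in> I"
    and sub: "\<And>A B. B \<in> I \<Longrightarrow> A \<subseteq> B \<Longrightarrow> A \<in> I"
  shows "banach_space (c0_ideal I)"
  unfolding c0_ideal_def
proof (rule banach_space_sup_norm_space)
  fix x y :: "nat \<Rightarrow> real" assume x: "x \<in> {x. bounded (range x) \<and> (\<forall>e>0. {n. e \<le> \<bar>x n\<bar>} \<in> I)}"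
    and y: "y \<in> {x. bounded (range x) \<and> (\<forall>e>0. {n. e \<le> \<bar>x n\<bar>} \<in> I)}"
  obtain B where "\<And>n. \<bar>x n\<bar> \<le> B" using x unfolding bounded_iff by auto
  moreover obtain C where "\<And>n. \<bar>y n\<bar> \<le> C" using y unfolding bounded_iff by auto
  ultimately have "\<bar>x n + y n\<bar> \<le> B + C" for n
    by (meson abs_triangle_ineq add_mono order_trans)
  then have "bounded (range (\<lambda>i. x i + y i))"
    unfolding bounded_iff by auto
  moreover have "{n. e \<le> \<bar>x n + y n\<bar>} \<in> I" if "e > 0" for e
  proof (rule sub[OF un])
    show "{n. e / 2 \<le> \<bar>x n\<bar>} \<in> I" "{n. e / 2 \<le> \<bar>y n\<bar>} \<in> I"
      using x y half_gt_zero[OF that] by blast+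
    show "{n. e \<le> \<bar>x n + y n\<bar>} \<subseteq> {n. e / 2 \<le> \<bar>x n\<bar>} \<union> {n. e / 2 \<le> \<bar>y n\<bar>}"
    proof clarsimp
      fix n assume "e \<le> \<bar>x n + y n\<bar>" "\<not> e \<le> \<bar>y n\<bar> * 2"
      then show "e \<le> \<bar>x n\<bar> * 2" using abs_triangle_ineq[of "x n" "y n"] by linarith
    qed
  qed
  ultimately show "(\<lambda>i\<in>UNIV. x i + y i) \<in> {x. bounded (range x) \<and> (\<forall>e>0. {n. e \<le> \<bar>x n\<bar>} \<in> I)}"
    by simp
next
  fix x :: "nat \<Rightarrow> real" and c assume x: "x \<in> {x. bounded (range x) \<and> (\<forall>e>0. {n. e \<le> \<bar>x n\<bar>} \<in> I)}"
  have "bounded (range (\<lambda>i. c * x i))"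
    using bounded_scaling[of "range x" c] x by (simp add: image_image)
  moreover have "{n. e \<le> \<bar>c * x n\<bar>} \<in> I" if "e > 0" for e
  proof (cases "c = 0")
    case False
    then have "{n. e \<le> \<bar>c * x n\<bar>} = {n. e / \<bar>c\<bar> \<le> \<bar>x n\<bar>}"
      by (simp add: abs_mult pos_divide_le_eq mult.commute)
    then show ?thesis using x that False by auto
  qed (use that empty in simp)
  ultimately show "(\<lambda>i\<in>UNIV. c * x i) \<in> {x. bounded (range x) \<and> (\<forall>e>0. {n. e \<le> \<bar>x n\<bar>} \<in> I)}"
    by simp
next
  fix s :: "nat \<Rightarrow> nat \<Rightarrow> real" and x
  assume s: "\<And>n. s n \<in> {x. bounded (range x) \<and> (\<forall>e>0. {n. e \<le> \<bar>x n\<bar>} \<in> I)}"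
    and u: "uniform_limit UNIV s x sequentially"
  have close: "\<exists>n. \<forall>i. \<bar>s n i - x i\<bar> < e" if "e > 0" for e
    using u that unfolding uniform_limit_iff eventually_sequentially dist_real_def by blast
  obtain n where n: "\<And>i. \<bar>s n i - x i\<bar> < 1" using close[of 1] by auto
  obtain B where B: "\<And>i. \<bar>s n i\<bar> \<le> B" using s[of n] unfolding bounded_iff by auto
  have "\<bar>x i\<bar> \<le> B + 1" for i using n[of i] B[of i] by linarith
  then have "bounded (range x)" unfolding bounded_iff by auto
  moreover have "{i. e \<le> \<bar>x i\<bar>} \<in> I" if e: "e > 0" for e
  proof -
    obtain n where n: "\<And>i. \<bar>s n i - x i\<bar> < e / 2" using close[of "e/2"] e by auto
    have "{i. e \<le> \<bar>x i\<bar>} \<subseteq> {i. e / 2 \<le> \<bar>s n i\<bar>}"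
    proof clarify
      fix i assume "e \<le> \<bar>x i\<bar>" then show "e / 2 \<le> \<bar>s n i\<bar>" using n[of i] by linarith
    qed
    moreover have "{i. e / 2 \<le> \<bar>s n i\<bar>} \<in> I"
      using s[of n] half_gt_zero[OF e] by blast
    ultimately show ?thesis by (rule sub[rotated])
  qed
  ultimately show "x \<in> {x. bounded (range x) \<and> (\<forall>e>0. {n. e \<le> \<bar>x n\<bar>} \<in> I)}" by simp
qed (use empty in \<open>auto simp: not_le\<close>)

lemma banach_space_c0_ad_ideal: "banach_space (c0_ideal (ad_ideal \<A>))"
proof (rule banach_space_c0_ideal)
  fix A B assume "A \<in> ad_ideal \<A>" "B \<in> ad_ideal \<A>"
  then obtain P Q where "P \<subseteq> \<A>" "finite P" "finite (A - \<Union>P)" "Q \<subseteq> \<A>" "finite Q" "finite (B - \<Union>Q)"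
    by (auto simp: ad_ideal_def)
  then show "A \<union> B \<in> ad_ideal \<A>"
    unfolding ad_ideal_def
    by (intro CollectI exI[of _ "P \<union> Q"]) (auto intro: finite_subset[of _ "(A - \<Union>P) \<union> (B - \<Union>Q)"])
next
  fix A B assume "B \<in> ad_ideal \<A>" "A \<subseteq> B"
  then show "A \<in> ad_ideal \<A>"
    unfolding ad_ideal_def by (blast intro: finite_subset[OF Diff_mono[OF _ subset_refl]])
qed (auto simp: ad_ideal_def)

lemma algebra_ad_algebra: "algebra UNIV (ad_algebra \<A>)"
  unfolding ad_algebra_def by (rule hull_in) (auto simp: algebra_iff_Int)

lemma ultrafilter_extension:
  assumes B: "algebra UNIV \<B>" and G: "G \<subseteq> \<B>"
    and fip: "\<And>F. F \<subseteq> G \<Longrightarrow> finite F \<Longrightarrow> \<Inter>F \<noteq> {}"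
  shows "\<exists>U\<in>ultrafilters_of \<B>. G \<subseteq> U"
proof -
  define P where "P = {M. G \<subseteq> M \<and> M \<subseteq> \<B> \<and> (\<forall>F. F \<subseteq> M \<longrightarrow> finite F \<longrightarrow> \<Inter>F \<noteq> {})}"
  have "\<exists>M\<in>P. \<forall>X\<in>P. M \<subseteq> X \<longrightarrow> X = M"
  proof (rule subset_Zorn_nonempty)
    show "P \<noteq> {}" using G fip by (auto simp: P_def)
  next
    fix \<C> assume ne: "\<C> \<noteq> {}" and ch: "subset.chain P \<C>"
    then have \<C>: "\<C> \<subseteq> P" by (simp add: subset_chain_def)
    have "\<Inter>F \<noteq> {}" if F: "F \<subseteq> \<Union>\<C>" "finite F" for F
    proof -
      obtain M where "M \<in> \<C>" "F \<subseteq> M" using finite_subset_Union_chain[OF F(2,1) ne ch] .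
      then show ?thesis using \<C> F(2) unfolding P_def by (metis (mono_tags, lifting) mem_Collect_eq subsetD)
    qed
    moreover have "G \<subseteq> C \<and> C \<subseteq> \<B>" if "C \<in> \<C>" for C using \<C> that by (auto simp: P_def)
    then have "G \<subseteq> \<Union>\<C>" "\<Union>\<C> \<subseteq> \<B>" using ne by blast+
    ultimately show "\<Union>\<C> \<in> P" unfolding P_def by simp
  qed
  then obtain M where M: "M \<in> P" and max: "\<And>X. X \<in> P \<Longrightarrow> M \<subseteq> X \<Longrightarrow> X = M" by blast
  have ne: "\<Inter>F \<noteq> {}" if "F \<subseteq> M" "finite F" for F using M that by (simp add: P_def)
  have mem: "b \<in> M" if b: "b \<in> \<B>" and meet: "\<And>F. F \<subseteq> M \<Longrightarrow> finite F \<Longrightarrow> \<Inter>F \<inter> b \<noteq> {}" for b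
  proof -
    have "\<Inter>F \<noteq> {}" if F: "F \<subseteq> insert b M" "finite F" for F
    proof -
      have "\<Inter>(F - {b}) \<inter> b \<noteq> {}" using F by (intro meet) auto
      then show ?thesis by blast
    qed
    then have "insert b M \<in> P" using M b by (auto simp: P_def)
    then show ?thesis using max by blast
  qed
  have up: "b \<in> M" if b: "b \<in> \<B>" and F: "F \<subseteq> M" "finite F" "\<Inter>F \<subseteq> b" for b F
  proof (rule mem[OF b])
    fix H assume "H \<subseteq> M" "finite H"
    then have "\<Inter>(H \<union> F) \<noteq> {}" using F by (intro ne) auto
    then show "\<Inter>H \<inter> b \<noteq> {}" using F(3) by blast
  qed
  have MB: "M \<subseteq> \<B>" using M by (simp add: P_def)
  have "M \<in> ultrafilters_of \<B>"
    unfolding ultrafilters_of_def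
  proof (intro CollectI conjI ballI impI)
    show "UNIV \<in> M" by (rule up[of _ "{}"]) (use B in \<open>auto simp: algebra_iff_Int\<close>)
    show "{} \<notin> M" using ne[of "{{}}"] by auto
    show "a \<inter> b \<in> M" if "a \<in> M" "b \<in> M" for a b
      by (rule up[of _ "{a, b}"]) (use B MB that in \<open>auto simp: algebra_iff_Int\<close>)
    show "b \<in> M" if "a \<in> M" "b \<in> \<B>" "a \<subseteq> b" for a b
      by (rule up[of _ "{a}"]) (use that in auto)
    show "b \<in> M \<or> - b \<in> M" if b: "b \<in> \<B>" for b
    proof (rule disjCI)
      assume "- b \<notin> M"
      have "- b \<in> \<B>" using B b by (auto simp: algebra_iff_Int Compl_eq_Diff_UNIV)
      then have "\<not> \<Inter>F \<subseteq> - b" if "F \<subseteq> M" "finite F" for F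
        using up that \<open>- b \<notin> M\<close> by blast
      then show "b \<in> M" by (intro mem[OF b]) blast
    qed
  qed (use MB in auto)
  then show ?thesis using M by (auto simp: P_def)
qed

lemma ultrafilters_ofD:
  assumes "U \<in> ultrafilters_of \<B>"
  shows "U \<subseteq> \<B>" "UNIV \<in> U" "{} \<notin> U" "\<And>a b. a \<in> U \<Longrightarrow> b \<in> U \<Longrightarrow> a \<inter> b \<in> U"
    "\<And>a b. a \<in> U \<Longrightarrow> b \<in> \<B> \<Longrightarrow> a \<subseteq> b \<Longrightarrow> b \<in> U" "\<And>b. b \<in> \<B> \<Longrightarrow> b \<in> U \<or> - b \<in> U"
  using assms unfolding ultrafilters_of_def by simp_all

lemma topspace_stone_space: "UNIV \<in> \<B> \<Longrightarrow> topspace (stone_space \<B>) = ultrafilters_of \<B>"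
  by (auto simp: stone_space_def dest: ultrafilters_ofD(2))

lemma compact_space_stone_space:
  assumes B: "algebra UNIV \<B>"
  shows "compact_space (stone_space \<B>)"
proof -
  have int: "a \<inter> b \<in> \<B>" if "a \<in> \<B>" "b \<in> \<B>" for a b using B that by (auto simp: algebra_iff_Int)
  have compl: "- b \<in> \<B>" if "b \<in> \<B>" for b
    using B that by (auto simp: algebra_iff_Int Compl_eq_Diff_UNIV)
  have "UNIV \<in> \<B>" using compl[of "{}"] B by (auto simp: algebra_iff_Int)
  note top = topspace_stone_space[OF this]
  define N where "N b = {U \<in> ultrafilters_of \<B>. b \<in> U}" for b
  have N_int: "N (a \<inter> b) = N a \<inter> N b" if "a \<in> \<B>" "b \<in> \<B>" for a b
  proof -
    have "a \<inter> b \<in> U \<longleftrightarrow> a \<in> U \<and> b \<in> U" if U: "U \<in> ultrafilters_of \<B>" for U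
      using ultrafilters_ofD(4,5)[OF U] \<open>a \<in> \<B>\<close> \<open>b \<in> \<B>\<close> by (meson Int_lower1 Int_lower2)
    then show ?thesis by (auto simp: N_def)
  qed
  have base: "\<exists>b\<in>\<B>. U \<in> N b \<and> N b \<subseteq> S" if "openin (stone_space \<B>) S" "U \<in> S" for S U
  proof -
    have "generate_topology_on (N ` \<B>) S"
      using that(1) unfolding stone_space_def N_def by (rule openin_topology_generated_by)
    then show ?thesis using that(2)
    proof (induction arbitrary: U)
      case (Int S T)
      then obtain a b where "a \<in> \<B>" "U \<in> N a" "N a \<subseteq> S" "b \<in> \<B>" "U \<in> N b" "N b \<subseteq> T" by blast
      then show ?case
        by (intro bexI[of _ "a \<inter> b"] conjI) (auto simp: N_int int)
    next
      case (UN K)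
      then obtain k where k: "k \<in> K" "U \<in> k" by blast
      then obtain b where "b \<in> \<B>" "U \<in> N b" "N b \<subseteq> k" using UN.IH by metis
      then show ?case using k(1) by (intro bexI[of _ b]) auto
    next
      case (Basis S)
      then obtain b where "b \<in> \<B>" "S = N b" by blast
      then show ?case using Basis.prems by auto
    qed simp
  qed
  have "\<exists>\<F>. finite \<F> \<and> \<F> \<subseteq> \<U> \<and> ultrafilters_of \<B> \<subseteq> \<Union>\<F>"
    if op: "\<And>S. S \<in> \<U> \<Longrightarrow> openin (stone_space \<B>) S" and cov: "ultrafilters_of \<B> \<subseteq> \<Union>\<U>" for \<U>
  proof -
    define G where "G = {c \<in> \<B>. \<exists>S\<in>\<U>. N (- c) \<subseteq> S}"
    have "\<exists>F\<subseteq>G. finite F \<and> \<Inter>F = {}"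
    proof (rule ccontr)
      assume "\<not> ?thesis"
      then have "\<Inter>F \<noteq> {}" if "F \<subseteq> G" "finite F" for F using that by meson
      moreover have "G \<subseteq> \<B>" unfolding G_def by (rule Collect_restrict)
      ultimately obtain U where U: "U \<in> ultrafilters_of \<B>" "G \<subseteq> U"
        using ultrafilter_extension[OF B, of G] by meson
      then obtain S b where "S \<in> \<U>" "b \<in> \<B>" "U \<in> N b" "N b \<subseteq> S" using cov op base by blast
      then have "b \<in> U" and "- b \<in> G" using compl[of b] by (simp_all add: N_def G_def, metis)
      then have "b \<inter> - b \<in> U" using U by (intro ultrafilters_ofD(4)[OF U(1)]) auto
      then show False using ultrafilters_ofD(3)[OF U(1)] by simp
    qed
    then obtain F where F: "F \<subseteq> G" "finite F" "\<Inter>F = {}" by blast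
    have G: "c \<in> \<B> \<and> (\<exists>S\<in>\<U>. N (- c) \<subseteq> S)" if "c \<in> G" for c
      using that unfolding G_def by (rule CollectD)
    then have "\<forall>c\<in>F. \<exists>S\<in>\<U>. N (- c) \<subseteq> S" using F(1) by blast
    then obtain h where h: "\<And>c. c \<in> F \<Longrightarrow> h c \<in> \<U> \<and> N (- c) \<subseteq> h c" by metis
    have "U \<in> \<Union>(h ` F)" if U: "U \<in> ultrafilters_of \<B>" for U
    proof -
      have "\<Inter>H \<in> U" if "finite H" "H \<subseteq> U" for H
        using that by induction (simp_all add: ultrafilters_ofD(2,4)[OF U])
      then have "\<not> F \<subseteq> U" using F(2,3) ultrafilters_ofD(3)[OF U] by metis
      then obtain c where c: "c \<in> F" "c \<notin> U" by blast
      then have "c \<in> \<B>" using F(1) G by blast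
      then have "U \<in> N (- c)" using U c ultrafilters_ofD(6)[OF U] by (auto simp: N_def)
      then show ?thesis using h c by blast
    qed
    then show ?thesis using F(2) h by (intro exI[of _ "h ` F"]) auto
  qed
  then show ?thesis unfolding compact_space_alt top by blast
qed

lemma banach_space_franklin_compactum:
  "banach_space (continuous_function_space (franklin_compactum \<A>))"
proof (rule banach_space_continuous_function_space)
  note B = algebra_ad_algebra[of \<A>]
  show "compact_space (franklin_compactum \<A>)"
    unfolding franklin_compactum_def by (rule compact_space_stone_space[OF B])
  have "UNIV \<in> ad_algebra \<A>" using B by (force simp: algebra_iff_Int)
  then show "topspace (franklin_compactum \<A>) \<noteq> {}"
    using ultrafilter_extension[OF B, of "{}"]
    by (auto simp: franklin_compactum_def topspace_stone_space)
qed

end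

theory Submission
  imports Defs
begin

text \<open>
  Both spaces \<^term>\<open>X\<close> contain disjointly supported functions \<^term>\<open>e i\<close>, bounded by 1, and
  admit a weak* null sequence of functionals \<^term>\<open>f k\<close> with \<^term>\<open>f k (e i) = (if i = k then 1 else 0)\<close>.
  Such a sequence is never weakly null. Signed finite sums of the \<^term>\<open>e i\<close> lie in the unit ball
  of \<^term>\<open>X\<close>, so \<open>(\<Sum>i. \<bar>g (e i)\<bar>)\<close> is at most the norm of \<^term>\<open>g\<close> for every functional \<^term>\<open>g\<close>;
  hence \<open>g \<mapsto> (\<Sum>i. g (e i))\<close> is a bounded functional on the dual, and it takes the value 1 on
  every \<^term>\<open>f k\<close>. This is \<open>not_grothendieck_if_biorthogonal\<close>.

  For the Franklin compactum, the isolated points given by the elements of a member \<^term>\<open>A\<close> of the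
  family converge to the point at infinity of \<^term>\<open>A\<close>. The differences between evaluation at these
  isolated points and evaluation at their limit serve as the functionals, and the indicators of the
  isolated points as the \<^term>\<open>e i\<close>.

  For the ideal space, point evaluations suffice when the family is finite: properness leaves
  infinitely many points outside its union, and every set of the ideal contains only finitely many of
  them. When the family is infinite it may be maximal, and then no sequence of evaluations at distinct
  points is weak* null, because it has infinitely many terms in some set of the family. Limits along
  free ultrafilters work instead. Take distinct members \<^term>\<open>A k\<close> and an ultrafilter
  concentrated on each. A set of the ideal is, up to finitely many points, covered by finitely many
  members of the family, so it is negligible for the ultrafilters of all but finitely many \<^term>\<open>A k\<close>.
  That gives weak* convergence to zero. The \<^term>\<open>A k\<close> become disjoint after removing finitely many
  points from each one relative to its predecessors, and their indicators are then the \<^term>\<open>e i\<close>.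
\<close>

section \<open>Biorthogonal sequences and the Grothendieck property\<close>

lemma sum_abs_disjoint_le:
  fixes a :: "nat \<Rightarrow> real"
  assumes le: "\<And>i. \<bar>a i\<bar> \<le> 1" and disj: "\<And>i j. i \<noteq> j \<Longrightarrow> a i = 0 \<or> a j = 0"
  shows "(\<Sum>i<n. \<bar>a i\<bar>) \<le> 1"
proof (cases "\<exists>j<n. a j \<noteq> 0")
  case True
  then obtain j where j: "j < n" "a j \<noteq> 0" by blast
  then have "a i = 0" if "i \<noteq> j" for i using disj[OF that] by simp
  then have "(\<Sum>i<n. \<bar>a i\<bar>) = (\<Sum>i\<in>{j}. \<bar>a i\<bar>)"
    using j by (intro sum.mono_neutral_right) auto
  then show ?thesis using le[of j] by simp
qed simp

text \<open>
  The map \<open>g \<mapsto> (\<Sum>i. g (e i))\<close> separates the sequence \<^term>\<open>f\<close> from zero. It is bounded on the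
  dual because \<open>(\<Sum>i<n. \<bar>g (e i)\<bar>)\<close> is the value of \<^term>\<open>g\<close> at the sum of the first \<^term>\<open>n\<close>
  functions with the signs of the \<^term>\<open>g (e i)\<close>, and at each point at most one summand of
  that sum is nonzero.
\<close>

lemma not_grothendieck_if_biorthogonal:
  fixes S :: "'i set" and V :: "('i \<Rightarrow> real) set"
  defines "X \<equiv> sup_norm_space S V"
  assumes X: "banach_space X" and S: "S \<noteq> {}"
    and f: "weak_star_null X f"
    and e: "\<And>i. e i \<in> V" "\<And>i s. s \<in> S \<Longrightarrow> \<bar>e i s\<bar> \<le> 1"
    and disj: "\<And>i j s. s \<in> S \<Longrightarrow> i \<noteq> j \<Longrightarrow> e i s = 0 \<or> e j s = 0"
    and bi: "\<And>k i. f k (e i) = (if i = k then 1 else 0)"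
  shows "\<not> grothendieck_space X"
proof
  interpret banach_space X by (rule X)
  have cX: "vcarrier X = V" by (simp add: X_def sup_norm_space_def)
  have norm_nonneg: "0 \<le> vnorm X x" if x: "x \<in> V" for x
  proof -
    have "vnorm X (vzero X) = 0" using norm_eq_zero[OF zero_closed] by simp
    then show ?thesis
      using norm_triangle[of x "vscale X (- 1) x"] add_inverse[of x] scale_closed[of x "- 1"]
        norm_scale[of x "- 1"] x by (simp add: cX)
  qed
  have bf: "\<exists>C. \<forall>x\<in>V. \<bar>g x\<bar> \<le> C * vnorm X x" if "g \<in> bounded_functionals X" for g
    using that by (simp add: bounded_functionals_def cX)
  define y where "y c n = (\<lambda>s\<in>S. \<Sum>i<n. c i * e i s)" for c :: "nat \<Rightarrow> real" and n
  have y_Suc: "y c (Suc n) = vadd X (y c n) (vscale X (c n) (e n))" for c n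
    by (auto simp: y_def X_def sup_norm_space_def fun_eq_iff)
  have y_in: "y c n \<in> V" for c n
  proof (induction n)
    case 0
    have "y c 0 = vzero X" by (simp add: y_def X_def sup_norm_space_def)
    then show ?case using zero_closed by (simp add: cX)
  next
    case (Suc n)
    then show ?case
      using add_closed[of "y c n"] scale_closed[of "e n"] e(1) by (simp add: cX y_Suc)
  qed
  have y_norm: "vnorm X (y c n) \<le> 1" if c: "\<And>i. \<bar>c i\<bar> \<le> 1" for c n
  proof -
    have "\<bar>y c n s\<bar> \<le> 1" if s: "s \<in> S" for s
    proof -
      have "\<bar>y c n s\<bar> \<le> (\<Sum>i<n. \<bar>c i * e i s\<bar>)" using s by (simp add: y_def)
      also have "\<dots> \<le> 1"
      proof (rule sum_abs_disjoint_le)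
        show "\<bar>c i * e i s\<bar> \<le> 1" for i
          using mult_le_one[OF c[of i] _ e(2)[OF s, of i]] by (simp add: abs_mult)
        show "c i * e i s = 0 \<or> c j * e j s = 0" if "i \<noteq> j" for i j
          using disj[OF s that] by auto
      qed
      finally show ?thesis .
    qed
    then show ?thesis using S by (auto simp: X_def sup_norm_space_def intro: cSUP_least)
  qed
  have sum_le: "(\<Sum>i<n. \<bar>g (e i)\<bar>) \<le> vnorm (dual_space X) g" if g: "g \<in> bounded_functionals X" for g n
  proof -
    have g_add: "g (vadd X u v) = g u + g v" if "u \<in> V" "v \<in> V" for u v
      using g that by (simp add: bounded_functionals_def cX)
    have g_scale: "g (vscale X c u) = c * g u" if "u \<in> V" for u c
      using g that by (simp add: bounded_functionals_def cX)
    obtain C where C: "\<And>x. x \<in> V \<Longrightarrow> \<bar>g x\<bar> \<le> C * vnorm X x"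
      using bf[OF g] by blast
    have g_y: "g (y c n) = (\<Sum>i<n. c i * g (e i))" for c n
    proof (induction n)
      case 0
      have "y c 0 = vscale X 0 (y c 0)" by (auto simp: y_def X_def sup_norm_space_def)
      then show ?case using g_scale[OF y_in, of 0 c 0] by simp
    next
      case (Suc n)
      then show ?case
        using g_add[OF y_in, of "vscale X (c n) (e n)"] g_scale[OF e(1)] scale_closed[of "e n"] e(1)
        by (simp add: y_Suc cX)
    qed
    define c where "c i = sgn (g (e i))" for i
    have c1: "\<bar>c i\<bar> \<le> 1" for i by (simp add: c_def abs_sgn_eq)
    have "\<bar>g x\<bar> \<le> \<bar>C\<bar>" if "x \<in> V" "vnorm X x \<le> 1" for x
    proof -
      have "C * vnorm X x \<le> \<bar>C\<bar> * 1"
        using norm_nonneg[OF that(1)] that(2) by (intro mult_mono) auto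
      then show ?thesis using C[OF that(1)] by simp
    qed
    then have "\<bar>g (y c n)\<bar> \<le> vnorm (dual_space X) g"
      unfolding dual_space_def nvs.simps
      by (intro cSUP_upper bdd_aboveI2[where M="\<bar>C\<bar>"]) (auto simp: cX y_in y_norm c1)
    moreover have "g (y c n) = (\<Sum>i<n. \<bar>g (e i)\<bar>)"
      by (simp add: g_y c_def abs_sgn mult.commute)
    ultimately show ?thesis by linarith
  qed
  have summ: "summable (\<lambda>i. \<bar>g (e i)\<bar>)" if "g \<in> bounded_functionals X" for g
    using sum_le[OF that]
    by (intro bounded_imp_summable[of _ "vnorm (dual_space X) g"])
      (simp_all only: abs_ge_zero flip: lessThan_Suc_atMost)
  have summ': "summable (\<lambda>i. g (e i))" if "g \<in> bounded_functionals X" for g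
    using summ[OF that] by (rule summable_rabs_cancel)
  define \<Phi> where "\<Phi> = (\<lambda>g\<in>bounded_functionals X. \<Sum>i. g (e i))"
  have cD: "vcarrier (dual_space X) = bounded_functionals X" by (simp add: dual_space_def)
  have add_bf: "(\<lambda>x\<in>V. g x + h x) \<in> bounded_functionals X"
    if gh: "g \<in> bounded_functionals X" "h \<in> bounded_functionals X" for g h
  proof -
    obtain C D where CD: "\<And>x. x \<in> V \<Longrightarrow> \<bar>g x\<bar> \<le> C * vnorm X x"
        "\<And>x. x \<in> V \<Longrightarrow> \<bar>h x\<bar> \<le> D * vnorm X x"
      using bf[OF gh(1)] bf[OF gh(2)] by blast
    have "\<bar>g x + h x\<bar> \<le> (C + D) * vnorm X x" if "x \<in> V" for x
      using CD[OF that] abs_triangle_ineq[of "g x" "h x"] unfolding distrib_right by linarith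
    then have "\<exists>C. \<forall>x\<in>V. \<bar>g x + h x\<bar> \<le> C * vnorm X x" by blast
    then show ?thesis
      using gh add_closed scale_closed by (simp add: bounded_functionals_def cX algebra_simps)
  qed
  have scale_bf: "(\<lambda>x\<in>V. c * g x) \<in> bounded_functionals X"
    if g: "g \<in> bounded_functionals X" for g c
  proof -
    obtain C where "\<And>x. x \<in> V \<Longrightarrow> \<bar>g x\<bar> \<le> C * vnorm X x"
      using bf[OF g] by blast
    then have "\<bar>c * g x\<bar> \<le> (\<bar>c\<bar> * C) * vnorm X x" if "x \<in> V" for x
      using that by (simp add: abs_mult mult.assoc mult_left_mono)
    then have "\<exists>C. \<forall>x\<in>V. \<bar>c * g x\<bar> \<le> C * vnorm X x" by blast
    then show ?thesis
      using g add_closed scale_closed by (simp add: bounded_functionals_def cX algebra_simps)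
  qed
  have "\<Phi> \<in> bounded_functionals (dual_space X)"
    unfolding bounded_functionals_def[of "dual_space X"] cD
  proof (intro CollectI conjI ballI allI exI)
    show "\<Phi> \<in> extensional (bounded_functionals X)" by (simp add: \<Phi>_def)
  next
    fix g h assume gh: "g \<in> bounded_functionals X" "h \<in> bounded_functionals X"
    then show "\<Phi> (vadd (dual_space X) g h) = \<Phi> g + \<Phi> h"
      using suminf_add[OF summ'[OF gh(1)] summ'[OF gh(2)]] e(1)
      by (simp add: \<Phi>_def dual_space_def cX add_bf)
  next
    fix c g assume g: "g \<in> bounded_functionals X"
    then show "\<Phi> (vscale (dual_space X) c g) = c * \<Phi> g"
      using suminf_mult[OF summ'[OF g], of c] e(1)
      by (simp add: \<Phi>_def dual_space_def cX scale_bf)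
  next
    fix g assume g: "g \<in> bounded_functionals X"
    have "\<bar>\<Phi> g\<bar> \<le> (\<Sum>i. \<bar>g (e i)\<bar>)"
      using summable_rabs[OF summ[OF g]] g by (simp add: \<Phi>_def)
    also have "\<dots> \<le> vnorm (dual_space X) g"
      using sum_le[OF g] by (intro suminf_le_const[OF summ[OF g]]) auto
    finally show "\<bar>\<Phi> g\<bar> \<le> 1 * vnorm (dual_space X) g" by simp
  qed
  moreover assume "grothendieck_space X"
  then have "weakly_null (dual_space X) f" using f by (simp add: grothendieck_space_def)
  ultimately have "(\<lambda>k. \<Phi> (f k)) \<longlonglongrightarrow> 0"
    by (simp add: weakly_null_def dual_space_def[of "dual_space X"])
  moreover have "\<Phi> (f k) = 1" for k
    using f sums_single[of k "\<lambda>_. 1 :: real"]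
    by (auto simp: \<Phi>_def bi weak_star_null_def cD sums_iff)
  ultimately show False by (simp add: LIMSEQ_const_iff)
qed

lemma abs_le_vnorm_sup_norm_space:
  assumes "bounded (x ` S)" "i \<in> S"
  shows "\<bar>x i\<bar> \<le> vnorm (sup_norm_space S V) x"
proof -
  obtain B where "\<And>i. i \<in> S \<Longrightarrow> \<bar>x i\<bar> \<le> B"
    using assms(1) unfolding bounded_iff by auto
  then show ?thesis
    unfolding sup_norm_space_def nvs.simps
    using assms(2) by (intro cSUP_upper bdd_aboveI2[where M=B]) auto
qed

section \<open>Continuous functions on the Franklin compactum\<close>

text \<open>
  This dichotomy makes the sets that almost contain \<^term>\<open>A\<close> an ultrafilter of the algebra, the
  point at infinity of \<^term>\<open>A\<close>. An empty family generates the finite and cofinite sets, and for these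
  any set \<^term>\<open>A\<close> has the property.
\<close>

lemma ad_algebra_dichotomy:
  assumes A: "\<A> = {} \<or> A \<in> \<A>" and ad: "almost_disjoint_family \<A>" and b: "b \<in> ad_algebra \<A>"
  shows "finite (A - b) \<or> finite (A \<inter> b)"
proof -
  have "ad_algebra \<A> \<subseteq> {b. finite (A - b) \<or> finite (A \<inter> b)}"
    unfolding ad_algebra_def
  proof (rule hull_minimal)
    have "finite (A - b) \<or> finite (A \<inter> b)" if "b \<in> \<A>" for b
      using A ad that by (cases "A = b") (auto simp: almost_disjoint_family_def)
    then show "\<A> \<union> {F. finite F} \<subseteq> {b. finite (A - b) \<or> finite (A \<inter> b)}" by auto
    have "finite (A - (a \<inter> b)) \<or> finite (A \<inter> (a \<inter> b))"
      if "finite (A - a) \<or> finite (A \<inter> a)" "finite (A - b) \<or> finite (A \<inter> b)" for a b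
    proof -
      have "A - (a \<inter> b) = (A - a) \<union> (A - b)" by blast
      moreover have "A \<inter> (a \<inter> b) \<subseteq> A \<inter> a" "A \<inter> (a \<inter> b) \<subseteq> A \<inter> b" by auto
      ultimately show ?thesis using that by (metis finite_UnI finite_subset)
    qed
    then show "algebra UNIV {b. finite (A - b) \<or> finite (A \<inter> b)}"
      by (auto simp: algebra_iff_Int Diff_Diff_Int simp flip: Compl_eq_Diff_UNIV) (simp_all add: Diff_eq)
  qed
  then show ?thesis using b by blast
qed

lemma limitin_stone_space:
  assumes B: "UNIV \<in> \<B>" and U: "U \<in> ultrafilters_of \<B>" and u: "\<And>n. u n \<in> ultrafilters_of \<B>"
    and conv: "\<And>b. b \<in> U \<Longrightarrow> \<forall>\<^sub>F n in F. b \<in> u n"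
  shows "limitin (stone_space \<B>) u U F"
  unfolding limitin_def
proof (intro conjI allI impI)
  show "U \<in> topspace (stone_space \<B>)" using U B by (simp add: topspace_stone_space)
  fix T assume "openin (stone_space \<B>) T \<and> U \<in> T"
  then have "generate_topology_on ((\<lambda>b. {U \<in> ultrafilters_of \<B>. b \<in> U}) ` \<B>) T" and "U \<in> T"
    unfolding stone_space_def by (auto dest: openin_topology_generated_by)
  then show "\<forall>\<^sub>F n in F. u n \<in> T"
  proof (induction)
    case (Int a b)
    then show ?case by (auto intro: eventually_conj)
  next
    case (UN K)
    then obtain k where "k \<in> K" "U \<in> k" by blast
    then show ?case using UN.IH[of k] by (auto elim: eventually_mono)
  next
    case (Basis s)
    then show ?case using conv u by auto
  qed simp
qed

lemma not_grothendieck_franklin: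
  assumes ad: "almost_disjoint_family \<A>"
  shows "\<not> grothendieck_space (continuous_function_space (franklin_compactum \<A>))"
proof -
  define \<B> where "\<B> = ad_algebra \<A>"
  have alg: "algebra UNIV \<B>" unfolding \<B>_def by (rule algebra_ad_algebra)
  have compl: "- b \<in> \<B>" if "b \<in> \<B>" for b
    using alg that by (auto simp: algebra_iff_Int Compl_eq_Diff_UNIV)
  have UNIV_B: "UNIV \<in> \<B>" using alg compl[of "{}"] by (auto simp: algebra_iff_Int)
  have Int_B: "a \<inter> b \<in> \<B>" if "a \<in> \<B>" "b \<in> \<B>" for a b
    using alg that by (auto simp: algebra_iff_Int)
  have fin_B: "b \<in> \<B>" if "finite b" for b
    using that hull_subset[of "\<A> \<union> {F. finite F}" "algebra UNIV"] by (auto simp: \<B>_def ad_algebra_def)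
  define K where "K = franklin_compactum \<A>"
  have K: "K = stone_space \<B>" by (simp add: K_def \<B>_def franklin_compactum_def)
  have top: "topspace K = ultrafilters_of \<B>" by (simp add: K topspace_stone_space[OF UNIV_B])
  obtain A where A: "\<A> = {} \<or> A \<in> \<A>" "infinite A"
    using ad infinite_UNIV_nat unfolding almost_disjoint_family_def by (metis equals0I)
  have dich: "finite (A - b) \<or> finite (A \<inter> b)" if "b \<in> \<B>" for b
    using ad_algebra_dichotomy[OF A(1) ad] that by (simp add: \<B>_def)
  define a where "a = enumerate A"
  have a: "strict_mono a" "\<And>n. a n \<in> A"
    using A(2) by (auto simp: a_def strict_mono_enumerate enumerate_in_set)
  \<comment> \<open>\<open>p n\<close> is the isolated point of the compactum given by \<open>n\<close>, and \<open>q\<close> is the point at infinity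
    of \<open>A\<close>.\<close>
  define p where "p n = {b \<in> \<B>. n \<in> b}" for n
  define q where "q = {b \<in> \<B>. finite (A - b)}"
  have p: "p n \<in> ultrafilters_of \<B>" for n
    by (auto simp: ultrafilters_of_def p_def UNIV_B Int_B compl)
  have q: "q \<in> ultrafilters_of \<B>"
    unfolding ultrafilters_of_def
  proof (intro CollectI conjI ballI impI)
    show "{} \<notin> q" using A(2) by (simp add: q_def)
    show "b \<inter> c \<in> q" if "b \<in> q" "c \<in> q" for b c
      using that by (simp add: q_def Int_B Diff_Int)
    show "c \<in> q" if "b \<in> q" "c \<in> \<B>" "b \<subseteq> c" for b c
      using that by (auto simp: q_def intro: finite_subset[OF Diff_mono[OF subset_refl]])
    show "b \<in> q \<or> - b \<in> q" if "b \<in> \<B>" for b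
      using dich[OF that] that compl[OF that] by (auto simp: q_def Diff_eq)
  qed (auto simp: q_def UNIV_B)
  have lim: "limitin K (\<lambda>n. p (a n)) q sequentially"
    unfolding K
  proof (rule limitin_stone_space[OF UNIV_B q p])
    fix b assume b: "b \<in> q"
    then have "finite (A - b)" "b \<in> \<B>" by (auto simp: q_def)
    then have "finite {n. a n \<in> A - b}"
      using finite_vimageI[of "A - b" a] a(1) by (simp add: vimage_def strict_mono_imp_inj_on)
    then have "\<forall>\<^sub>F n in sequentially. \<not> a n \<in> A - b"
      by (simp add: cofinite_eq_sequentially[symmetric] eventually_cofinite)
    then show "\<forall>\<^sub>F n in sequentially. b \<in> p (a n)"
      by eventually_elim (use a \<open>b \<in> \<B>\<close> in \<open>auto simp: p_def\<close>)
  qed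
  define V where "V = {f \<in> extensional (topspace K). continuous_map K euclideanreal f}"
  have X: "continuous_function_space K = sup_norm_space (topspace K) V"
    by (simp add: continuous_function_space_def V_def)
  have le: "\<bar>x i\<bar> \<le> vnorm (sup_norm_space (topspace K) V) x" if "x \<in> V" "i \<in> topspace K" for x i
  proof (rule abs_le_vnorm_sup_norm_space[OF _ that(2)])
    have "compactin euclideanreal (x ` topspace K)"
      using that(1) compact_space_stone_space[OF alg] image_compactin[of K "topspace K" euclideanreal x]
      by (auto simp: V_def K compact_space_def)
    then show "bounded (x ` topspace K)" by (simp add: compact_imp_bounded)
  qed
  define f where "f n = (\<lambda>x\<in>V. x (p (a n)) - x q)" for n
  define e where "e n = (\<lambda>U\<in>topspace K. if {a n} \<in> U then 1 else 0 :: real)" for n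
  have f_bf: "f n \<in> bounded_functionals (continuous_function_space K)" for n
  proof -
    interpret banach_space "continuous_function_space K"
      unfolding K_def by (rule banach_space_franklin_compactum)
    have "\<bar>x (p (a n)) - x q\<bar> \<le> 2 * vnorm (sup_norm_space (topspace K) V) x" if "x \<in> V" for x
      using le[OF that, of "p (a n)"] le[OF that, of q] p q by (simp add: top)
    then show ?thesis
      using add_closed scale_closed p q
      by (auto simp: bounded_functionals_def X sup_norm_space_def f_def top algebra_simps)
  qed
  have "\<not> grothendieck_space (sup_norm_space (topspace K) V)"
  proof (rule not_grothendieck_if_biorthogonal)
    show "banach_space (sup_norm_space (topspace K) V)"
      using banach_space_franklin_compactum[of \<A>] by (simp add: K_def[symmetric] X)
    show "topspace K \<noteq> {}" using q top by auto
    have "(\<lambda>n. f n x) \<longlonglongrightarrow> 0" if "x \<in> V" for x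
    proof -
      have "limitin euclideanreal (x \<circ> (\<lambda>n. p (a n))) (x q) sequentially"
        using that continuous_map_limit[OF _ lim, of euclideanreal x] by (auto simp: V_def)
      then have "(\<lambda>n. x (p (a n))) \<longlonglongrightarrow> x q" by (simp add: o_def)
      then show ?thesis using that by (simp add: f_def LIM_zero)
    qed
    then show "weak_star_null (sup_norm_space (topspace K) V) f"
      using f_bf by (simp add: weak_star_null_def dual_space_def X) (simp add: sup_norm_space_def)
    show "e i \<in> V" for i
    proof -
      have "openin K {U \<in> topspace K. b \<in> U}" if "b \<in> \<B>" for b
        unfolding top using that unfolding K stone_space_def
        by (intro topology_generated_by_Basis) auto
      note op = this[OF fin_B] this[OF compl[OF fin_B]]
      have "topspace K - {U \<in> topspace K. {a i} \<in> U} = {U \<in> topspace K. - {a i} \<in> U}"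
      proof -
        have "{a i} \<notin> U \<longleftrightarrow> - {a i} \<in> U" if U: "U \<in> ultrafilters_of \<B>" for U
          using ultrafilters_ofD(3,4,6)[OF U] fin_B[of "{a i}"] by fastforce
        then show ?thesis by (auto simp: top)
      qed
      then have clopen: "closedin K {U \<in> topspace K. {a i} \<in> U}"
        using op(2)[of "{a i}"] by (auto simp: closedin_def)
      have "continuous_map K euclideanreal (\<lambda>U. if {a i} \<in> U then 1 else 0)"
      proof (rule continuous_map_cases_alt)
        show "continuous_map (subtopology K (K closure_of {x \<in> topspace K. {a i} \<in> x})) euclideanreal (\<lambda>U. 1)"
          by simp
        show "continuous_map (subtopology K (K closure_of {x \<in> topspace K. {a i} \<notin> x})) euclideanreal (\<lambda>U. 0)"
          by simp
        fix x assume x: "x \<in> K frontier_of {x \<in> topspace K. {a i} \<in> x}"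
        have "K frontier_of {x \<in> topspace K. {a i} \<in> x} = {}"
          using clopen op(1)[of "{a i}"] frontier_of_eq_empty[of "{x \<in> topspace K. {a i} \<in> x}" K] by auto
        then show "(1::real) = 0" using x by simp
      qed
      then show ?thesis
        by (auto simp: V_def e_def intro: continuous_map_eq)
    qed
    show "\<bar>e i U\<bar> \<le> 1" if "U \<in> topspace K" for i U using that by (simp add: e_def)
    show "e i U = 0 \<or> e j U = 0" if "U \<in> topspace K" "i \<noteq> j" for i j U
    proof -
      have "{a i} \<inter> {a j} = {}" using a(1) that(2) by (simp add: strict_mono_eq)
      then have "\<not> ({a i} \<in> U \<and> {a j} \<in> U)"
        using ultrafilters_ofD(3,4)[of U \<B>] that(1) unfolding top by metis
      then show ?thesis using that by (auto simp: e_def)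
    qed
    then show "f k (e i) = (if i = k then 1 else 0)" for k i
      using \<open>\<And>i. e i \<in> V\<close> p q A(2) a(1) fin_B[of "{a i}"]
      by (auto simp: f_def e_def top p_def q_def strict_mono_eq)
  qed
  then show ?thesis using X by (simp add: K_def)
qed

section \<open>Functions vanishing along an ideal\<close>

text \<open>
  Ultrafilters on a set are taken here as filters in the sense of \<^typ>\<open>'a filter\<close>, so that the
  library of limits applies to the functionals \<^term>\<open>\<lambda>x. Lim F x\<close>.
\<close>

definition is_ultrafilter :: "'a filter \<Rightarrow> bool" where
  "is_ultrafilter F \<longleftrightarrow> F \<noteq> bot \<and> (\<forall>P. eventually P F \<or> eventually (\<lambda>x. \<not> P x) F)"

lemma is_ultrafilter_principal: "is_ultrafilter (principal {x})"
  by (auto simp: is_ultrafilter_def eventually_principal principal_eq_bot_iff)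

lemma ex_free_ultrafilter:
  assumes A: "infinite A"
  shows "\<exists>F. is_ultrafilter F \<and> (\<forall>b. finite (A - b) \<longrightarrow> eventually (\<lambda>x. x \<in> b) F)"
proof -
  have "\<exists>U\<in>ultrafilters_of UNIV. {b. finite (A - b)} \<subseteq> U"
  proof (rule ultrafilter_extension)
    show "algebra UNIV (UNIV :: 'a set set)" by (simp add: algebra_iff_Int)
    show "\<Inter>\<F> \<noteq> {}" if "\<F> \<subseteq> {b. finite (A - b)}" "finite \<F>" for \<F>
    proof
      assume "\<Inter>\<F> = {}"
      then have "A = (\<Union>b\<in>\<F>. A - b)" by blast
      then show False using that A by (metis (mono_tags, lifting) finite_UN_I mem_Collect_eq subsetD)
    qed
  qed simp
  then obtain U where U: "U \<in> ultrafilters_of UNIV" "{b. finite (A - b)} \<subseteq> U" by blast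
  note UD = ultrafilters_ofD[OF U(1)]
  define F where "F = Abs_filter (\<lambda>P. Collect P \<in> U)"
  have ev: "eventually P F \<longleftrightarrow> Collect P \<in> U" for P
    unfolding F_def
  proof (rule eventually_Abs_filter, unfold_locales)
    show "Collect (\<lambda>x. True) \<in> U" using UD(2) by simp
    show "Collect (\<lambda>x. P x \<and> Q x) \<in> U" if "Collect P \<in> U" "Collect Q \<in> U" for P Q
      using UD(4)[OF that] by (simp add: Collect_conj_eq)
    show "Collect Q \<in> U" if "\<forall>x. P x \<longrightarrow> Q x" "Collect P \<in> U" for P Q
      using UD(5)[OF that(2), of "Collect Q"] that(1) by auto
  qed
  have "is_ultrafilter F"
    using UD(3) UD(6) by (auto simp: is_ultrafilter_def trivial_limit_def ev Collect_neg_eq)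
  then show ?thesis using U(2) by (intro exI[of _ F]) (auto simp: ev)
qed

text \<open>
  The values lie in a compact ball, so they cluster at some point along \<^term>\<open>F\<close>; for an
  ultrafilter a cluster point is a limit.
\<close>

lemma ultrafilter_bounded_tendsto:
  fixes x :: "'a \<Rightarrow> real"
  assumes F: "is_ultrafilter F" and x: "bounded (range x)"
  shows "(x \<longlongrightarrow> Lim F x) F"
proof -
  obtain B where B: "\<And>n. x n \<in> cball 0 B" using x unfolding bounded_iff by auto
  have "filtermap x F \<noteq> bot" "eventually (\<lambda>y. y \<in> cball 0 B) (filtermap x F)"
    using F B by (auto simp: is_ultrafilter_def filtermap_bot_iff eventually_filtermap)
  then obtain l where l: "inf (nhds l) (filtermap x F) \<noteq> bot"
    using compact_cball[of "0::real" B] unfolding compact_filter by blast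
  have "(x \<longlongrightarrow> l) F"
  proof (rule topological_tendstoI, rule ccontr)
    fix T assume T: "open T" "l \<in> T" "\<not> (\<forall>\<^sub>F n in F. x n \<in> T)"
    then have "\<forall>\<^sub>F n in F. x n \<notin> T" using F by (auto simp: is_ultrafilter_def)
    then have "eventually (\<lambda>y. y \<notin> T) (filtermap x F)" by (simp add: eventually_filtermap)
    moreover have "eventually (\<lambda>y. y \<in> T) (nhds l)" using T by (simp add: eventually_nhds_in_open)
    ultimately have "eventually (\<lambda>y. False) (inf (nhds l) (filtermap x F))"
      unfolding eventually_inf by blast
    then show False using l by (simp add: eventually_False)
  qed
  then show ?thesis using tendsto_Lim F by (metis is_ultrafilter_def)
qed

text \<open>
  The limits along the \<^term>\<open>F k\<close> and the indicators of the \<^term>\<open>D k\<close> are biorthogonal. The sets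
  where an element of the space is bounded away from zero lie in \<^term>\<open>I\<close>, so the last hypothesis
  makes the limits weak* null.
\<close>

lemma not_grothendieck_c0_ideal:
  assumes ban: "banach_space (c0_ideal I)"
    and F: "\<And>k. is_ultrafilter (F k)"
    and D: "\<And>k. D k \<in> I" "disjoint_family D" "\<And>k. eventually (\<lambda>n. n \<in> D k) (F k)"
    and small: "\<And>B. B \<in> I \<Longrightarrow> \<forall>\<^sub>F k in sequentially. eventually (\<lambda>n. n \<notin> B) (F k)"
  shows "\<not> grothendieck_space (c0_ideal I)"
proof -
  define V where "V = {x :: nat \<Rightarrow> real. bounded (range x) \<and> (\<forall>e>0. {n. \<bar>x n\<bar> \<ge> e} \<in> I)}"
  have X: "c0_ideal I = sup_norm_space UNIV V" by (simp add: c0_ideal_def V_def)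
  interpret banach_space "sup_norm_space UNIV V" using ban by (simp add: X)
  have nb: "F k \<noteq> bot" for k using F by (simp add: is_ultrafilter_def)
  have "(\<lambda>n. 0) \<in> V" using zero_closed by (simp add: sup_norm_space_def restrict_UNIV)
  then have "\<forall>r>0. {n. r \<le> \<bar>0 :: real\<bar>} \<in> I" unfolding V_def by blast
  from this[rule_format, of 1] have empty: "{} \<in> I" by simp
  have lim: "(x \<longlongrightarrow> Lim (F k) x) (F k)" if "x \<in> V" for x k
    using ultrafilter_bounded_tendsto[OF F] that by (simp add: V_def)
  have Lim_le: "\<bar>Lim (F k) x\<bar> \<le> c" if "x \<in> V" "\<forall>\<^sub>F n in F k. \<bar>x n\<bar> \<le> c" for x k c
    using tendsto_upperbound[OF tendsto_rabs[OF lim[OF that(1)]] that(2)] nb by simp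
  define f where "f k = (\<lambda>x\<in>V. Lim (F k) x)" for k
  define e where "e k = (indicator (D k) :: nat \<Rightarrow> real)" for k
  have "\<not> grothendieck_space (sup_norm_space UNIV V)"
  proof (rule not_grothendieck_if_biorthogonal)
    show "banach_space (sup_norm_space UNIV V)" using ban by (simp add: X)
    have "f k \<in> bounded_functionals (sup_norm_space UNIV V)" for k
    proof -
      have "Lim (F k) (\<lambda>n. x n + y n) = Lim (F k) x + Lim (F k) y" if "x \<in> V" "y \<in> V" for x y
        using tendsto_Lim[OF nb tendsto_add[OF lim lim]] that by simp
      moreover have "Lim (F k) (\<lambda>n. c * x n) = c * Lim (F k) x" if "x \<in> V" for c x
        using tendsto_Lim[OF nb tendsto_mult_left[OF lim]] that by simp
      moreover have "\<bar>Lim (F k) x\<bar> \<le> 1 * vnorm (sup_norm_space UNIV V) x" if "x \<in> V" for x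
        using abs_le_vnorm_sup_norm_space[of x UNIV _ V] that
        by (intro Lim_le) (auto simp: V_def)
      then have "\<exists>C. \<forall>x\<in>V. \<bar>Lim (F k) x\<bar> \<le> C * vnorm (sup_norm_space UNIV V) x" by blast
      ultimately show ?thesis
        using add_closed scale_closed unfolding bounded_functionals_def f_def
        by (simp add: sup_norm_space_def restrict_UNIV)
    qed
    moreover have "(\<lambda>k. f k x) \<longlonglongrightarrow> 0" if x: "x \<in> V" for x
    proof (rule tendstoI)
      fix r :: real assume r: "r > 0"
      have "{n. r / 2 \<le> \<bar>x n\<bar>} \<in> I" using x half_gt_zero[OF r] unfolding V_def by blast
      from small[OF this] show "\<forall>\<^sub>F k in sequentially. dist (f k x) 0 < r"
      proof eventually_elim
        case (elim k)
        then have "\<bar>Lim (F k) x\<bar> \<le> r / 2"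
          by (intro Lim_le[OF x]) (auto elim: eventually_mono)
        then show ?case using r x by (simp add: f_def)
      qed
    qed
    ultimately show "weak_star_null (sup_norm_space UNIV V) f"
      by (simp add: weak_star_null_def dual_space_def) (simp add: sup_norm_space_def)
    show eV: "e i \<in> V" for i
    proof -
      have "{n. r \<le> \<bar>e i n\<bar>} = (if r \<le> 1 then D i else {})" if "r > 0" for r
        using that by (auto simp: e_def indicator_def)
      moreover have "bounded (range (e i))"
        by (auto simp: bounded_iff e_def indicator_def intro!: exI[of _ 1])
      ultimately show ?thesis using D(1) empty by (simp add: V_def)
    qed
    show "\<bar>e i n\<bar> \<le> 1" for i n by (simp add: e_def indicator_def)
    show "e i n = 0 \<or> e j n = 0" if "i \<noteq> j" for i j n
      using D(2) that by (auto simp: e_def indicator_def disjoint_family_on_def)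
    show "f k (e i) = (if i = k then 1 else 0)" for k i
    proof -
      have "\<forall>\<^sub>F n in F k. e i n = (if i = k then 1 else 0)"
        using D(3)[of k] by eventually_elim (use D(2) in \<open>auto simp: e_def indicator_def disjoint_family_on_def\<close>)
      then have "Lim (F k) (e i) = (if i = k then 1 else 0)"
        by (intro tendsto_Lim[OF nb] tendsto_eventually)
      then show ?thesis using eV by (simp add: f_def)
    qed
  qed simp
  then show ?thesis by (simp add: X)
qed

text \<open>
  In the finite case the ultrafilters are principal at points outside the union of the family; in
  the infinite case they are free and live on distinct members of the family.
\<close>

lemma not_grothendieck_c0_ad_ideal:
  assumes ad: "almost_disjoint_family \<A>" and proper: "UNIV \<notin> ad_ideal \<A>"
  shows "\<not> grothendieck_space (c0_ideal (ad_ideal \<A>))"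
proof (cases "finite \<A>")
  case True
  define B where "B = - \<Union>\<A>"
  have "infinite B" using proper True by (auto simp: ad_ideal_def B_def Compl_eq_Diff_UNIV)
  then have b: "inj (enumerate B)" "\<And>k. enumerate B k \<in> B"
    by (auto simp: strict_mono_enumerate strict_mono_imp_inj_on enumerate_in_set)
  show ?thesis
  proof (rule not_grothendieck_c0_ideal[OF banach_space_c0_ad_ideal is_ultrafilter_principal])
    show "{enumerate B k} \<in> ad_ideal \<A>" for k by (auto simp: ad_ideal_def)
    show "disjoint_family (\<lambda>k. {enumerate B k})"
      using b(1) by (auto simp: disjoint_family_on_def inj_eq)
    show "\<forall>\<^sub>F n in principal {enumerate B k}. n \<in> {enumerate B k}" for k
      by (simp add: eventually_principal)
    fix C assume "C \<in> ad_ideal \<A>"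
    then obtain \<A>0 where "\<A>0 \<subseteq> \<A>" "finite (C - \<Union>\<A>0)" by (auto simp: ad_ideal_def)
    then have "finite (C \<inter> B)" by (auto simp: B_def elim!: rev_finite_subset)
    then have "finite {k. enumerate B k \<in> C \<inter> B}"
      using finite_vimageI[of "C \<inter> B", OF _ b(1)] by (simp add: vimage_def)
    then show "\<forall>\<^sub>F k in sequentially. \<forall>\<^sub>F n in principal {enumerate B k}. n \<notin> C"
      using b(2) by (simp add: cofinite_eq_sequentially[symmetric] eventually_cofinite eventually_principal)
  qed
next
  case False
  then obtain A :: "nat \<Rightarrow> nat set" where A: "inj A" "range A \<subseteq> \<A>"
    using infinite_countable_subset by blast
  have inf: "infinite (A k)" for k using ad A(2) by (auto simp: almost_disjoint_family_def)
  have afin: "finite (A k \<inter> B)" if "B \<in> \<A>" "A k \<noteq> B" for k B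
    using ad range_subsetD[OF A(2), of k] that by (simp add: almost_disjoint_family_def)
  obtain F where F: "\<And>k. is_ultrafilter (F k)"
    "\<And>k b. finite (A k - b) \<Longrightarrow> eventually (\<lambda>n. n \<in> b) (F k)"
    using ex_free_ultrafilter[OF inf] by metis
  define D where "D k = A k - (\<Union>j<k. A j)" for k
  show ?thesis
  proof (rule not_grothendieck_c0_ideal[OF banach_space_c0_ad_ideal F(1)])
    show "D k \<in> ad_ideal \<A>" for k
    proof -
      have "D k - \<Union>{A k} = {}" by (auto simp: D_def)
      then have "finite (D k - \<Union>{A k})" by (simp only: finite.emptyI)
      then show ?thesis
        using range_subsetD[OF A(2), of k] unfolding ad_ideal_def
        by (intro CollectI exI[of _ "{A k}"]) simp
    qed
    show "disjoint_family D"
      unfolding D_def disjoint_family_on_def 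
      by (metis (no_types, lifting) DiffD1 DiffD2 UN_I disjoint_iff lessThan_iff linorder_neqE_nat)
    show "\<forall>\<^sub>F n in F k. n \<in> D k" for k
    proof (rule F(2))
      have "A k - D k = (\<Union>j<k. A k \<inter> A j)" by (auto simp: D_def)
      moreover have "finite (A k \<inter> A j)" if "j < k" for j
        using that A by (intro afin) (auto simp: inj_eq)
      then have "finite (\<Union>j<k. A k \<inter> A j)" by (intro finite_UN_I) auto
      ultimately show "finite (A k - D k)" by (simp only:)
    qed
    fix B assume "B \<in> ad_ideal \<A>"
    then obtain \<A>0 where A0: "\<A>0 \<subseteq> \<A>" "finite \<A>0" "finite (B - \<Union>\<A>0)" by (auto simp: ad_ideal_def)
    have "finite {k. A k \<in> \<A>0}" using finite_vimageI[OF A0(2) A(1)] by (simp add: vimage_def)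
    then have "\<forall>\<^sub>F k in sequentially. A k \<notin> \<A>0"
      by (simp add: cofinite_eq_sequentially[symmetric] eventually_cofinite)
    then show "\<forall>\<^sub>F k in sequentially. \<forall>\<^sub>F n in F k. n \<notin> B"
    proof eventually_elim
      case (elim k)
      have "A k - - B \<subseteq> (\<Union>C\<in>\<A>0. A k \<inter> C) \<union> (B - \<Union>\<A>0)" by blast
      moreover have "finite (A k \<inter> C)" if "C \<in> \<A>0" for C
        using that A0(1) elim by (intro afin) auto
      ultimately have "finite (A k - - B)"
        using A0 by (meson finite_UN_I finite_UnI finite_subset)
      then show ?case using F(2)[of k "- B"] by simp
    qed
  qed
qed

theorem corollary2p11:
  fixes \<A> :: "nat set set"
  assumes "almost_disjoint_family \<A>"
  shows "\<not> grothendieck_space (continuous_function_space (franklin_compactum \<A>)) \<and>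
    (UNIV \<notin> ad_ideal \<A> \<longrightarrow> \<not> grothendieck_space (c0_ideal (ad_ideal \<A>)))"
  using not_grothendieck_franklin[OF assms] not_grothendieck_c0_ad_ideal[OF assms] by blast

end
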